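(* If a Banach space is strictly convex renormable (i.e. admits an equivalent strictly convex norm) and contains a complemented copy of $c_0(\mathbb{N})$, then it has an equivalent norm which is both strictly convex and almost square. In particular, any separable Banach space $X$ which contains a copy of $c_0$ (i.e. a subspace isomorphic to $c_0(\mathbb{N})$) admits an equivalent norm which is simultaneously strictly convex and almost square.
   Context: All spaces are real. A norm $\|\cdot\|$ is strictly convex if $\frac12\|x+y\|=\|x\|=\|y\|$ implies $x=y$. A Banach space $X$ (or its norm) is almost square if for every finite subset $x_1,\dots,x_n$ of the unit sphere $S_X$ and every $\varepsilon>0$ there is $y\in S_X$ with $\|x_i+y\|\le1+\varepsilon$ for all $i=1,\dots,n$. A complemented copy of $c_0(\mathbb{N})$ is a subspace isomorphic to $c_0(\mathbb{N})$ which is the range of a bounded linear projection. *)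

theory Defs
  imports "HOL-Analysis.Analysis"
begin

typedef c0 = "{f :: nat \<Rightarrow> real. f \<longlonglongrightarrow> 0}"
  morphisms c0_nth Abs_c0
  by (rule exI[of _ "\<lambda>_. 0"]) simp

setup_lifting type_definition_c0

lemma c0_nth_tendsto: "c0_nth x \<longlonglongrightarrow> 0"
  using c0_nth[of x] by simp

lemma c0_nth_bdd_above: "bdd_above (range (\<lambda>n. \<bar>c0_nth x n\<bar>))"
proof -
  have "Bseq (c0_nth x)"
    using c0_nth_tendsto[of x] convergentI convergent_imp_Bseq by blast
  then obtain K where "\<And>n. norm (c0_nth x n) \<le> K"
    unfolding Bseq_def by blast
  then show ?thesis
    by (intro bdd_aboveI[of _ K]) auto
qed

instantiation c0 :: real_vector
begin

lift_definition zero_c0 :: c0 is "\<lambda>_. 0" by simp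

lift_definition plus_c0 :: "c0 \<Rightarrow> c0 \<Rightarrow> c0" is "\<lambda>f g n. f n + g n"
  by (rule tendsto_add_zero)

lift_definition uminus_c0 :: "c0 \<Rightarrow> c0" is "\<lambda>f n. - f n"
  using tendsto_minus by fastforce

lift_definition minus_c0 :: "c0 \<Rightarrow> c0 \<Rightarrow> c0" is "\<lambda>f g n. f n - g n"
  using tendsto_diff by fastforce

lift_definition scaleR_c0 :: "real \<Rightarrow> c0 \<Rightarrow> c0" is "\<lambda>r f n. r * f n"
  by (rule tendsto_mult_right_zero)

instance
  by standard (transfer; simp add: algebra_simps)+

end

instantiation c0 :: real_normed_vector
begin

definition norm_c0 :: "c0 \<Rightarrow> real"
  where "norm_c0 x = (SUP n. \<bar>c0_nth x n\<bar>)"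

definition dist_c0 :: "c0 \<Rightarrow> c0 \<Rightarrow> real"
  where "dist_c0 x y = norm (x - y)"

definition sgn_c0 :: "c0 \<Rightarrow> c0"
  where "sgn_c0 x = x /\<^sub>R norm x"

definition uniformity_c0 :: "(c0 \<times> c0) filter"
  where "uniformity_c0 = (INF e\<in>{0<..}. principal {(x, y). dist x y < e})"

definition open_c0 :: "c0 set \<Rightarrow> bool"
  where "open_c0 S = (\<forall>x\<in>S. \<forall>\<^sub>F (x', y) in uniformity. x' = x \<longrightarrow> y \<in> S)"

lemma abs_c0_nth_le_norm: "\<bar>c0_nth x n\<bar> \<le> norm (x :: c0)"
  unfolding norm_c0_def by (rule cSUP_upper[OF _ c0_nth_bdd_above]) simp

lemma norm_c0_le: "(\<And>n. \<bar>c0_nth x n\<bar> \<le> K) \<Longrightarrow> norm (x :: c0) \<le> K"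
  unfolding norm_c0_def by (rule cSUP_least) auto

instance
proof
  fix x y :: c0 and r :: real
  show "dist x y = norm (x - y)" by (rule dist_c0_def)
  show "sgn x = x /\<^sub>R norm x" by (rule sgn_c0_def)
  show "uniformity = (INF e\<in>{0<..}. principal {(x, y :: c0). dist x y < e})"
    by (rule uniformity_c0_def)
  show "open U = (\<forall>x\<in>U. \<forall>\<^sub>F (x', y) in uniformity. x' = x \<longrightarrow> y \<in> U)" for U :: "c0 set"
    by (rule open_c0_def)
  show "norm x = 0 \<longleftrightarrow> x = 0"
  proof
    assume "norm x = 0"
    then have "c0_nth x n = 0" for n
      using abs_c0_nth_le_norm[of x n] by simp
    then show "x = 0" by transfer auto
  next
    assume "x = 0"
    then show "norm x = 0" by (simp add: norm_c0_def zero_c0.rep_eq)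
  qed
  show "norm (x + y) \<le> norm x + norm y"
  proof (rule norm_c0_le)
    fix n
    show "\<bar>c0_nth (x + y) n\<bar> \<le> norm x + norm y"
      using abs_c0_nth_le_norm[of x n] abs_c0_nth_le_norm[of y n]
      by (simp add: plus_c0.rep_eq)
  qed
  have le: "norm (t *\<^sub>R u) \<le> \<bar>t\<bar> * norm u" for t :: real and u :: c0
    by (rule norm_c0_le)
      (simp add: scaleR_c0.rep_eq abs_mult abs_c0_nth_le_norm mult_left_mono)
  show "norm (r *\<^sub>R x) = \<bar>r\<bar> * norm x"
  proof (cases "r = 0")
    case True
    have "r *\<^sub>R x = 0" using True by transfer simp
    then show ?thesis using True by (simp add: norm_c0_def zero_c0.rep_eq)
  next
    case False
    have "inverse r *\<^sub>R (r *\<^sub>R x) = x" using False by transfer (simp add: fun_eq_iff)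
    then have "norm x \<le> \<bar>inverse r\<bar> * norm (r *\<^sub>R x)" using le[of "inverse r" "r *\<^sub>R x"] by simp
    then have "\<bar>r\<bar> * norm x \<le> norm (r *\<^sub>R x)" using False by (simp add: field_simps)
    then show ?thesis using le[of r x] by simp
  qed
qed

end

instance c0 :: banach
proof
  fix X :: "nat \<Rightarrow> c0"
  assume X: "Cauchy X"
  have cau: "\<exists>M. \<forall>m\<ge>M. \<forall>k\<ge>M. \<forall>n. \<bar>c0_nth (X m) n - c0_nth (X k) n\<bar> < e" if e: "e > 0" for e
  proof -
    obtain M where "\<forall>m\<ge>M. \<forall>k\<ge>M. dist (X m) (X k) < e"
      using X e unfolding Cauchy_def by blast
    then show ?thesis
      by (metis abs_c0_nth_le_norm dist_norm le_less_trans minus_c0.rep_eq)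
  qed
  have "Cauchy (\<lambda>m. c0_nth (X m) n)" for n
    unfolding Cauchy_def dist_real_def using cau by meson
  then have "\<forall>n. \<exists>l. (\<lambda>m. c0_nth (X m) n) \<longlonglongrightarrow> l"
    by (simp add: Cauchy_convergent_iff convergent_def)
  then obtain l where l: "\<And>n. (\<lambda>m. c0_nth (X m) n) \<longlonglongrightarrow> l n"
    by metis
  have unif: "\<exists>M. \<forall>m\<ge>M. \<forall>n. \<bar>c0_nth (X m) n - l n\<bar> \<le> e" if e: "e > 0" for e
  proof -
    obtain M where M: "\<forall>m\<ge>M. \<forall>k\<ge>M. \<forall>n. \<bar>c0_nth (X m) n - c0_nth (X k) n\<bar> < e"
      using cau e by blast
    have "\<bar>c0_nth (X m) n - l n\<bar> \<le> e" if "m \<ge> M" for m n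
    proof (rule tendsto_upperbound)
      show "(\<lambda>k. \<bar>c0_nth (X m) n - c0_nth (X k) n\<bar>) \<longlonglongrightarrow> \<bar>c0_nth (X m) n - l n\<bar>"
        by (intro tendsto_intros l)
      show "\<forall>\<^sub>F k in sequentially. \<bar>c0_nth (X m) n - c0_nth (X k) n\<bar> \<le> e"
        using M that by (auto simp: eventually_sequentially intro!: exI[of _ M] less_imp_le)
    qed simp
    then show ?thesis by blast
  qed
  have "l \<longlonglongrightarrow> 0"
  proof (rule LIMSEQ_I)
    fix r :: real
    assume "r > 0"
    then obtain M where M: "\<forall>m\<ge>M. \<forall>n. \<bar>c0_nth (X m) n - l n\<bar> \<le> r / 2"
      using unif[of "r / 2"] by auto
    obtain N where N: "\<forall>n\<ge>N. norm (c0_nth (X M) n - 0) < r / 2"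
      using LIMSEQ_D[OF c0_nth_tendsto, of "r / 2" "X M"] \<open>r > 0\<close> by auto
    have "norm (l n - 0) < r" if "n \<ge> N" for n
    proof -
      have "\<bar>c0_nth (X M) n - l n\<bar> \<le> r / 2" using M by blast
      moreover have "\<bar>c0_nth (X M) n\<bar> < r / 2" using N that by auto
      moreover have "\<bar>l n\<bar> \<le> \<bar>c0_nth (X M) n\<bar> + \<bar>c0_nth (X M) n - l n\<bar>" by linarith
      ultimately show ?thesis by simp
    qed
    then show "\<exists>N. \<forall>n\<ge>N. norm (l n - 0) < r" by blast
  qed
  then have L: "c0_nth (Abs_c0 l) = l" by (simp add: Abs_c0_inverse)
  have "X \<longlonglongrightarrow> Abs_c0 l"
  proof (rule LIMSEQ_I)
    fix r :: real
    assume "r > 0"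
    then obtain M where M: "\<forall>m\<ge>M. \<forall>n. \<bar>c0_nth (X m) n - l n\<bar> \<le> r / 2"
      using unif[of "r / 2"] by auto
    then have "norm (X m - Abs_c0 l) \<le> r / 2" if "m \<ge> M" for m
      using that by (intro norm_c0_le) (simp add: minus_c0.rep_eq L)
    then show "\<exists>N. \<forall>m\<ge>N. norm (X m - Abs_c0 l) < r"
      using \<open>r > 0\<close> by (intro exI[of _ M]) fastforce
  qed
  then show "convergent X" by (rule convergentI)
qed

text \<open>
  An isomorphism of normed spaces is a linear bijection that is bounded in both directions;
  it need not be isometric.
\<close>

definition isomorphic_to_c0 :: "'a::real_normed_vector set \<Rightarrow> bool"
  where "isomorphic_to_c0 Y \<longleftrightarrow>
    (\<exists>T :: c0 \<Rightarrow> 'a. bounded_linear T \<and> range T = Y \<and>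
       (\<exists>c>0. \<forall>x. c * norm x \<le> norm (T x)))"

definition complemented :: "'a::real_normed_vector set \<Rightarrow> bool"
  where "complemented Y \<longleftrightarrow>
    (\<exists>P :: 'a \<Rightarrow> 'a. bounded_linear P \<and> P \<circ> P = P \<and> range P = Y)"

definition is_norm :: "('a::real_vector \<Rightarrow> real) \<Rightarrow> bool"
  where "is_norm p \<longleftrightarrow>
    (\<forall>x. p x = 0 \<longleftrightarrow> x = 0) \<and>
    (\<forall>x y. p (x + y) \<le> p x + p y) \<and>
    (\<forall>r x. p (r *\<^sub>R x) = \<bar>r\<bar> * p x)"

text \<open>Equivalence is always with respect to the norm that the type carries.\<close>

definition equivalent_norm :: "('a::real_normed_vector \<Rightarrow> real) \<Rightarrow> bool"
  where "equivalent_norm p \<longleftrightarrow> is_norm p \<and>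
    (\<exists>a>0. \<exists>b>0. \<forall>x. a * norm x \<le> p x \<and> p x \<le> b * norm x)"

definition strictly_convex :: "('a::real_vector \<Rightarrow> real) \<Rightarrow> bool"
  where "strictly_convex p \<longleftrightarrow>
    (\<forall>x y. p (x + y) / 2 = p x \<and> p x = p y \<longrightarrow> x = y)"

definition almost_square :: "('a::real_vector \<Rightarrow> real) \<Rightarrow> bool"
  where "almost_square p \<longleftrightarrow>
    (\<forall>F. finite F \<and> F \<subseteq> {x. p x = 1} \<longrightarrow>
      (\<forall>\<epsilon>>0. \<exists>y. p y = 1 \<and> (\<forall>x\<in>F. p (x + y) \<le> 1 + \<epsilon>)))"

end

theory Submission
  imports Defs "HOL-Library.Diagonal_Subsequence"
begin

text \<open>
  Suppose that \<open>c\<^sub>0\<close> sits complemented in \<open>X\<close>: there are bounded operators \<open>T\<close> from \<open>c\<^sub>0\<close> to \<open>X\<close>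
  and \<open>Q\<close> back with \<open>Q T = id\<close>. Write \<open>f\<^sub>n x\<close> for the \<open>n\<close>-th coordinate of \<open>Q x\<close> and let \<open>p\<close> be a
  strictly convex equivalent norm. The new norm is
  \<open>q x = sup\<^sub>n u\<^sub>n x\<close>, where \<open>u\<^sub>n x = sqrt (f\<^sub>n(x)^2 + (2^-n r(x))^2)\<close> and
  \<open>r x = sqrt (p(x - T Q x)^2 + \<Sum>k. (2^-k f\<^sub>k(x))^2)\<close>.

  Its behaviour rests on two features. First, \<open>u\<^sub>n x\<close> tends to 0 for each \<open>x\<close>, so the supremum is
  attained. If \<open>q (x + y) = 2 q x = 2 q y\<close> and the supremum at \<open>x + y\<close> is attained at \<open>m\<close>, then the
  same equalities hold for \<open>u\<^sub>m\<close>. Euclidean sums pass such equalities to their summands, so they hold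
  for \<open>r\<close>, then for \<open>p\<close> at \<open>x - T Q x\<close> and \<open>y - T Q y\<close> and for every \<open>f\<^sub>k\<close>, and give \<open>x = y\<close>.
  Secondly, for the unit vector \<open>e\<^sub>m\<close> of \<open>c\<^sub>0\<close> one has \<open>r (T e\<^sub>m) = 2^-m\<close>: adding a multiple of
  \<open>T e\<^sub>m\<close> hardly changes any \<open>u\<^sub>n\<close> with \<open>n \<noteq> m\<close>, while \<open>u\<^sub>m x\<close> is already close to 0. Hence
  \<open>T e\<^sub>m / q (T e\<^sub>m)\<close> is a witness of almost squareness as soon as \<open>m\<close> is large. This is
  \<open>strictly_convex_almost_square_renorming\<close>.

  If \<open>X\<close> is separable and contains a copy of \<open>c\<^sub>0\<close>, both hypotheses hold. The Euclidean sum of the norm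
  and a weighted Hilbertian seminorm built from a separating sequence of functionals is strictly convex
  (\<open>separable_strictly_convex_renorming\<close>). Every copy of \<open>c\<^sub>0\<close> is complemented (\<open>Sobczyk\<close>), by Veech's
  argument: extend the coordinate functionals to \<open>X\<close>; all their pointwise cluster points vanish on
  the copy, so subtracting from the \<open>n\<close>-th extension a nearby functional that vanishes on the copy
  makes the sequence pointwise null without changing it on the copy. Both facts use the
  Hahn--Banach theorem, which is proved first.
\<close>

section \<open>The Hahn--Banach theorem\<close>

definition sublinear :: "('a::real_vector \<Rightarrow> real) \<Rightarrow> bool"
  where "sublinear p \<longleftrightarrow>
    (\<forall>x y. p (x + y) \<le> p x + p y) \<and> (\<forall>r\<ge>0. \<forall>x. p (r *\<^sub>R x) = r * p x)"

lemma sublinear_add: "sublinear p \<Longrightarrow> p (x + y) \<le> p x + p y"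
  and sublinear_scale: "sublinear p \<Longrightarrow> r \<ge> 0 \<Longrightarrow> p (r *\<^sub>R x) = r * p x"
  by (auto simp: sublinear_def)

lemma sublinear_lower: "sublinear p \<Longrightarrow> - p (- x) \<le> p x"
  using sublinear_add[of p x "- x"] sublinear_scale[of p 0 0] by simp

text \<open>
  Three pointwise infima of families of functions occur below: over a chain, over the half-line in one
  direction, and over the domain of an operator. Subadditivity only needs an index \<open>k\<close> that
  serves a given pair \<open>i, j\<close>, so one lemma covers all of them.
\<close>

lemma sublinear_INF:
  fixes q :: "'i \<Rightarrow> 'a::real_vector \<Rightarrow> real"
  assumes ne: "I \<noteq> {}"
    and low: "\<And>i x. i \<in> I \<Longrightarrow> B x \<le> q i x"
    and add: "\<And>i j x y. i \<in> I \<Longrightarrow> j \<in> I \<Longrightarrow> \<exists>k\<in>I. q k (x + y) \<le> q i x + q j y"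
    and scale: "\<And>i r x. i \<in> I \<Longrightarrow> r > 0 \<Longrightarrow> \<exists>k\<in>I. q k (r *\<^sub>R x) \<le> r * q i x"
  shows "sublinear (\<lambda>x. INF i\<in>I. q i x)"
proof -
  define Q where "Q x = (INF i\<in>I. q i x)" for x
  have bdd: "bdd_below ((\<lambda>i. q i x) ` I)" for x
    using low by (intro bdd_belowI2)
  have Q_le: "Q x \<le> q i x" if "i \<in> I" for i x
    unfolding Q_def using bdd that by (rule cINF_lower)
  have Q_ge: "c \<le> Q x" if "\<And>i. i \<in> I \<Longrightarrow> c \<le> q i x" for c x
    unfolding Q_def using ne that by (rule cINF_greatest)
  have Q_add: "Q (x + y) \<le> Q x + Q y" for x y
  proof -
    have "Q (x + y) - q j y \<le> Q x" if j: "j \<in> I" for j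
    proof (rule Q_ge)
      fix i assume "i \<in> I"
      then obtain k where "k \<in> I" "q k (x + y) \<le> q i x + q j y"
        using add j by blast
      then show "Q (x + y) - q j y \<le> q i x"
        using Q_le[of k "x + y"] by linarith
    qed
    then have "Q (x + y) - Q x \<le> Q y"
      by (intro Q_ge) (smt (verit))
    then show ?thesis by simp
  qed
  have le: "Q (r *\<^sub>R x) \<le> r * Q x" if r: "r > 0" for r x
  proof -
    have "Q (r *\<^sub>R x) / r \<le> Q x"
    proof (rule Q_ge)
      fix i assume "i \<in> I"
      then obtain k where "k \<in> I" "q k (r *\<^sub>R x) \<le> r * q i x"
        using scale r by blast
      then have "Q (r *\<^sub>R x) \<le> r * q i x"
        using Q_le order_trans by blast
      then show "Q (r *\<^sub>R x) / r \<le> q i x"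
        using that by (simp add: field_simps)
    qed
    then show ?thesis using that by (simp add: field_simps)
  qed
  \<comment> \<open>The two factors bound \<open>Q 0\<close> by half of it and by twice it, which leaves only 0.\<close>
  have Q0: "Q 0 = 0"
    using le[of "1/2" 0] le[of 2 0] by simp
  have "Q (r *\<^sub>R x) = r * Q x" if "r \<ge> 0" for r x
  proof (cases "r = 0")
    case False
    then have r: "r > 0" using that by simp
    have "Q x \<le> inverse r * Q (r *\<^sub>R x)"
      using le[of "inverse r" "r *\<^sub>R x"] r by simp
    then have "r * Q x \<le> Q (r *\<^sub>R x)"
      using r by (simp add: field_simps)
    then show ?thesis using le[OF r, of x] by simp
  qed (simp add: Q0)
  then show ?thesis
    using Q_add by (simp add: sublinear_def flip: Q_def)
qed

text \<open>
  For fixed \<open>y\<close>, the infimum over \<open>t \<ge> 0\<close> of \<open>q (x + t y) - t q y\<close> is a sublinear function of \<open>x\<close> below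
  \<open>q\<close>. Minimality makes it equal to \<open>q\<close>, and the value at \<open>t = 1\<close> is then superadditivity of \<open>q\<close>.
\<close>

lemma minimal_sublinear_imp_linear:
  assumes q: "sublinear q"
    and min: "\<And>q'. sublinear q' \<Longrightarrow> (\<And>x. q' x \<le> q x) \<Longrightarrow> q' = q"
  shows "linear q"
proof -
  have "q x + q y \<le> q (x + y)" for x y
  proof -
    define s where "s x = (INF t\<in>{0..}. q (x + t *\<^sub>R y) - t * q y)" for x
    have low: "- q (- x) \<le> q (x + t *\<^sub>R y) - t * q y" if "t \<in> {0..}" for t x
    proof -
      have "q (t *\<^sub>R y) \<le> q (x + t *\<^sub>R y) + q (- x)"
        using sublinear_add[OF q, of "x + t *\<^sub>R y" "- x"] by simp
      then show ?thesis using sublinear_scale[OF q] that by simp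
    qed
    have s_le: "s x \<le> q (x + t *\<^sub>R y) - t * q y" if "t \<ge> 0" for x t
      unfolding s_def using low that
      by (intro cINF_lower bdd_belowI2[where m = "- q (- x)"]) auto
    have "sublinear s"
      unfolding s_def
    proof (rule sublinear_INF)
      fix t u :: real and x z
      assume tu: "t \<in> {0..}" "u \<in> {0..}"
      have "q ((x + z) + (t + u) *\<^sub>R y) \<le> q (x + t *\<^sub>R y) + q (z + u *\<^sub>R y)"
        using sublinear_add[OF q, of "x + t *\<^sub>R y" "z + u *\<^sub>R y"]
        by (simp add: algebra_simps)
      then show "\<exists>v\<in>{0..}. q ((x + z) + v *\<^sub>R y) - v * q y
          \<le> q (x + t *\<^sub>R y) - t * q y + (q (z + u *\<^sub>R y) - u * q y)"
        using tu by (intro bexI[of _ "t + u"]) (auto simp: algebra_simps)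
    next
      fix t r :: real and x
      assume t: "t \<in> {0..}" and r: "r > 0"
      have "q (r *\<^sub>R x + (r * t) *\<^sub>R y) = r * q (x + t *\<^sub>R y)"
        using sublinear_scale[OF q, of r "x + t *\<^sub>R y"] r by (simp add: algebra_simps)
      then show "\<exists>v\<in>{0..}. q (r *\<^sub>R x + v *\<^sub>R y) - v * q y \<le> r * (q (x + t *\<^sub>R y) - t * q y)"
        using t r by (intro bexI[of _ "r * t"]) (auto simp: algebra_simps)
    qed (use low in auto)
    moreover have "s x \<le> q x" for x
      using s_le[of 0 x] by simp
    ultimately have "s = q" by (rule min)
    then show ?thesis using s_le[of 1 x] by simp
  qed
  then have add: "q (x + y) = q x + q y" for x y
    using sublinear_add[OF q] by (simp add: order_antisym)
  have neg: "q (- x) = - q x" for x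
    using add[of x "- x"] sublinear_scale[OF q, of 0 0] by simp
  have "q (r *\<^sub>R x) = r * q x" for r x
  proof (cases "r \<ge> 0")
    case False
    then show ?thesis
      using neg[of "(- r) *\<^sub>R x"] sublinear_scale[OF q, of "- r" x] by simp
  qed (simp add: sublinear_scale[OF q])
  then show ?thesis using add by (intro linearI) auto
qed

text \<open>
  Zorn's lemma, applied downwards to the sublinear functions below \<open>p\<close>, yields a minimal one.
  The infimum over a chain stays finite because every sublinear \<open>q \<le> p\<close> satisfies \<open>q x \<ge> - p (- x)\<close>.
\<close>

lemma sublinear_dominates_linear:
  fixes p :: "'a::real_vector \<Rightarrow> real"
  assumes p: "sublinear p"
  obtains g where "linear g" "\<And>x. g x \<le> p x"
proof -
  define A where "A = {q. sublinear q \<and> (\<forall>x. q x \<le> p x)}"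
  define R where "R q q' \<longleftrightarrow> (\<forall>x. q' x \<le> q x)" for q q' :: "'a \<Rightarrow> real"
  have "\<exists>m\<in>A. \<forall>a\<in>A. R m a \<longrightarrow> a = m"
  proof (rule predicate_Zorn)
    show "partial_order_on A (relation_of R A)"
      unfolding R_def by (rule partial_order_on_relation_ofI) (auto intro: order_trans simp: fun_eq_iff order_antisym)
  next
    fix C assume C: "C \<in> Chains (relation_of R A)"
    have CA: "q \<in> A" if "q \<in> C" for q
      using C that by (auto simp: Chains_def relation_of_def)
    have chain: "(\<forall>x. q x \<le> q' x) \<or> (\<forall>x. q' x \<le> q x)" if "q \<in> C" "q' \<in> C" for q q'
      using C that by (auto simp: Chains_def relation_of_def R_def)
    show "\<exists>u\<in>A. \<forall>a\<in>C. R a u"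
    proof (cases "C = {}")
      case True
      have "p \<in> A" using p by (simp add: A_def)
      then show ?thesis using True by blast
    next
      case False
      define s where "s x = (INF q\<in>C. q x)" for x
      have low: "- p (- x) \<le> q x" if "q \<in> C" for q x
        using CA[OF that] sublinear_lower[of q x] unfolding A_def
        by (smt (verit) mem_Collect_eq)
      have s_le: "s x \<le> q x" if "q \<in> C" for q x
        unfolding s_def using low that
        by (intro cINF_lower bdd_belowI2[where m = "- p (- x)"]) auto
      have "sublinear s"
        unfolding s_def
      proof (rule sublinear_INF)
        fix q q' x y assume qq: "q \<in> C" "q' \<in> C"
        obtain k where k: "k \<in> C" "\<And>z. k z \<le> q z" "\<And>z. k z \<le> q' z"
          using chain[OF qq] qq by (metis order_refl)
        have "k (x + y) \<le> k x + k y"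
          using CA[OF k(1)] by (auto simp: A_def sublinear_def)
        then show "\<exists>k\<in>C. k (x + y) \<le> q x + q' y"
          using k(1) k(2)[of x] k(3)[of y] by (intro bexI[of _ k]) auto
      next
        fix q r x assume "q \<in> C" "(0::real) < r"
        then show "\<exists>k\<in>C. k (r *\<^sub>R x) \<le> r * q x"
          using CA[of q] by (intro bexI[of _ q]) (auto simp: A_def sublinear_def)
      qed (use False low in auto)
      moreover have "s x \<le> p x" for x
      proof -
        obtain q where "q \<in> C" using False by blast
        then show ?thesis using s_le[of q x] CA[of q] by (auto simp: A_def intro: order_trans)
      qed
      ultimately show ?thesis
        using s_le by (intro bexI[of _ s]) (auto simp: A_def R_def)
    qed
  qed
  then obtain m where m: "m \<in> A" "\<And>a. a \<in> A \<Longrightarrow> R m a \<Longrightarrow> a = m"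
    by blast
  have "linear m"
  proof (rule minimal_sublinear_imp_linear)
    show "sublinear m" using m(1) by (simp add: A_def)
    fix q' assume "sublinear q'" and le: "\<And>x. q' x \<le> m x"
    then have "q' \<in> A" using m(1) by (auto simp: A_def intro: order_trans)
    then show "q' = m" using m(2) le by (simp add: R_def)
  qed
  then show ?thesis using that m(1) by (simp add: A_def)
qed

text \<open>
  The Hahn--Banach extension theorem, stated for the range of an operator \<open>T\<close> instead of a subspace, so
  that no partially defined functional appears. A linear function below the infimal convolution
  of \<open>C\<close> times the norm with \<open>\<phi>\<close> along \<open>T\<close> is below both \<open>C\<close> times the norm and, on the range of \<open>T\<close>, \<open>\<phi>\<close>;
  between linear functions the second inequality is an equality.
\<close>

theorem functional_factors_through:
  fixes T :: "'b::real_vector \<Rightarrow> 'a::real_normed_vector" and \<phi> :: "'b \<Rightarrow> real"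
  assumes T: "linear T" and \<phi>: "linear \<phi>"
    and bound: "\<And>b. \<phi> b \<le> C * norm (T b)" and C: "C \<ge> 0"
  obtains g where "linear g" "\<And>b. g (T b) = \<phi> b" "\<And>x. \<bar>g x\<bar> \<le> C * norm x"
proof -
  define s where "s x = (INF b\<in>UNIV. C * norm (x - T b) + \<phi> b)" for x
  have low: "- (C * norm x) \<le> C * norm (x - T b) + \<phi> b" for x b
  proof -
    have "- \<phi> b \<le> C * norm (T b)"
      using bound[of "- b"] by (simp add: linear_neg[OF T] linear_neg[OF \<phi>])
    moreover have "norm (T b) \<le> norm (x - T b) + norm x"
      by (metis add.commute norm_minus_commute norm_triangle_sub)
    then have "C * norm (T b) \<le> C * (norm (x - T b) + norm x)"
      using C by (rule mult_left_mono)
    ultimately show ?thesis by (simp add: distrib_left)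
  qed
  have s_le: "s x \<le> C * norm (x - T b) + \<phi> b" for x b
    unfolding s_def using low by (intro cINF_lower bdd_belowI2) auto
  have "sublinear s"
    unfolding s_def
  proof (rule sublinear_INF)
    fix a b x y
    have "norm ((x + y) - T (a + b)) \<le> norm (x - T a) + norm (y - T b)"
      unfolding linear_add[OF T] by (rule norm_diff_triangle_ineq)
    then have "C * norm ((x + y) - T (a + b)) \<le> C * (norm (x - T a) + norm (y - T b))"
      using C by (rule mult_left_mono)
    then show "\<exists>c\<in>UNIV. C * norm ((x + y) - T c) + \<phi> c
        \<le> C * norm (x - T a) + \<phi> a + (C * norm (y - T b) + \<phi> b)"
      by (intro bexI[of _ "a + b"]) (simp_all add: linear_add[OF \<phi>] distrib_left)
  next
    fix b x and r :: real assume r: "r > 0"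
    have "norm (r *\<^sub>R x - T (r *\<^sub>R b)) = r * norm (x - T b)"
      using r by (simp add: linear_cmul[OF T] flip: scaleR_diff_right)
    then show "\<exists>c\<in>UNIV. C * norm (r *\<^sub>R x - T c) + \<phi> c \<le> r * (C * norm (x - T b) + \<phi> b)"
      by (intro bexI[of _ "r *\<^sub>R b"]) (simp_all add: linear_cmul[OF \<phi>] distrib_left)
  qed (use low in auto)
  then obtain g where g: "linear g" "\<And>x. g x \<le> s x"
    using sublinear_dominates_linear by blast
  have g_le: "g x \<le> C * norm x" for x
    using g(2)[of x] s_le[of x 0] by (simp add: linear_0[OF T] linear_0[OF \<phi>])
  have gT_le: "g (T b) \<le> \<phi> b" for b
    using g(2)[of "T b"] s_le[of "T b" b] by simp
  show ?thesis
  proof (rule that[OF g(1)])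
    show "g (T b) = \<phi> b" for b
      using gT_le[of b] gT_le[of "- b"]
      by (simp add: linear_neg[OF T] linear_neg[OF \<phi>] linear_neg[OF g(1)])
    show "\<bar>g x\<bar> \<le> C * norm x" for x
      using g_le[of x] g_le[of "- x"] by (simp add: linear_neg[OF g(1)] abs_le_iff)
  qed
qed

corollary norming_functional:
  fixes x :: "'a::real_normed_vector"
  obtains g where "linear g" "g x = norm x" "\<And>y. \<bar>g y\<bar> \<le> norm y"
proof (rule functional_factors_through[of "\<lambda>t. t *\<^sub>R x" "\<lambda>t. t * norm x" 1])
  show "linear (\<lambda>t. t *\<^sub>R x)" "linear (\<lambda>t. t * norm x)"
    by (auto intro!: linearI simp: algebra_simps)
  show "t * norm x \<le> 1 * norm (t *\<^sub>R x)" for t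
    by (simp add: mult_right_mono)
  fix g assume "linear g" "\<And>t. g (t *\<^sub>R x) = t * norm x" "\<And>y. \<bar>g y\<bar> \<le> 1 * norm y"
  then show thesis using that[of g] by (metis mult_1 scaleR_one)
qed simp

section \<open>Projecting a separable space onto a copy of the space of null sequences\<close>

lemma equibounded_approx_on_dense:
  fixes f :: "nat \<Rightarrow> 'a::real_normed_vector \<Rightarrow> real"
  assumes lin: "\<And>n. linear (f n)" and bd: "\<And>n x. \<bar>f n x\<bar> \<le> C * norm x"
    and dense: "closure (range d) = UNIV" and e: "e > 0"
  obtains k where "\<And>n. \<bar>f n x - f n (d k)\<bar> \<le> e"
proof -
  define \<delta> where "\<delta> = e / (\<bar>C\<bar> + 1)"
  have \<delta>: "\<delta> > 0" using e by (simp add: \<delta>_def)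
  obtain k where k: "dist (d k) x < \<delta>"
    using dense \<delta> closure_approachable[of x "range d"] by auto
  have "\<bar>f n x - f n (d k)\<bar> \<le> e" for n
  proof -
    have "\<bar>f n x - f n (d k)\<bar> \<le> C * norm (x - d k)"
      using bd[of n "x - d k"] by (simp add: linear_diff[OF lin])
    also have "\<dots> \<le> (\<bar>C\<bar> + 1) * norm (x - d k)"
      by (rule mult_right_mono) auto
    also have "\<dots> \<le> (\<bar>C\<bar> + 1) * \<delta>"
      using k by (intro mult_left_mono) (auto simp: dist_norm norm_minus_commute)
    also have "\<dots> = e"
      by (simp add: \<delta>_def)
    finally show ?thesis .
  qed
  then show ?thesis by (rule that)
qed

lemma convergent_of_dense_range:
  fixes f :: "nat \<Rightarrow> 'a::real_normed_vector \<Rightarrow> real"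
  assumes lin: "\<And>n. linear (f n)" and bd: "\<And>n x. \<bar>f n x\<bar> \<le> C * norm x"
    and dense: "closure (range d) = UNIV"
    and lim: "\<And>k. convergent (\<lambda>n. f n (d k))"
  shows "convergent (\<lambda>n. f n x)"
proof -
  have "Cauchy (\<lambda>n. f n x)"
  proof (rule metric_CauchyI)
    fix e :: real assume e: "e > 0"
    then obtain k where close: "\<And>n. \<bar>f n x - f n (d k)\<bar> \<le> e / 4"
      using equibounded_approx_on_dense[where f = f and d = d and e = "e / 4" and x = x] lin bd dense
      by (metis zero_less_divide_iff zero_less_numeral)
    have "Cauchy (\<lambda>n. f n (d k))"
      using lim convergent_Cauchy by blast
    then obtain M where M: "\<And>m n. m \<ge> M \<Longrightarrow> n \<ge> M \<Longrightarrow> \<bar>f m (d k) - f n (d k)\<bar> < e / 2"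
      using metric_CauchyD[of "\<lambda>n. f n (d k)" "e/2"] e by (auto simp: dist_real_def)
    have "dist (f m x) (f n x) < e" if "m \<ge> M" "n \<ge> M" for m n
      using M[OF that] close[of m] close[of n] unfolding dist_real_def by linarith
    then show "\<exists>M. \<forall>m\<ge>M. \<forall>n\<ge>M. dist (f m x) (f n x) < e" by blast
  qed
  then show ?thesis by (simp add: Cauchy_convergent_iff)
qed

text \<open>
  The sequential Banach--Alaoglu theorem for the dual of a separable space: a diagonal subsequence
  converges on the dense sequence, and equiboundedness carries the convergence to every point.
\<close>

lemma functionals_pointwise_seq_compact:
  fixes f :: "nat \<Rightarrow> 'a::real_normed_vector \<Rightarrow> real" and d :: "nat \<Rightarrow> 'a"
  assumes lin: "\<And>n. linear (f n)" and bd: "\<And>n x. \<bar>f n x\<bar> \<le> C * norm x"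
    and dense: "closure (range d) = UNIV"
  obtains s g where "strict_mono s" "linear g" "\<And>x. \<bar>g x\<bar> \<le> C * norm x"
    "\<And>x. (\<lambda>j. f (s j) x) \<longlonglongrightarrow> g x"
proof -
  interpret subseqs "\<lambda>k s. convergent (\<lambda>j. f (s j) (d k))"
  proof
    fix k and s :: "nat \<Rightarrow> nat"
    have "f (s j) (d k) \<in> {- (C * norm (d k)) .. C * norm (d k)}" for j
      using bd[of "s j" "d k"] by (auto simp: abs_le_iff)
    then obtain l r where "strict_mono r" "((\<lambda>j. f (s j) (d k)) \<circ> r) \<longlonglongrightarrow> l"
      using compact_Icc seq_compactE[of "{- (C * norm (d k)) .. C * norm (d k)}" "\<lambda>j. f (s j) (d k)"]
      by (metis compact_imp_seq_compact)
    then show "\<exists>r. strict_mono r \<and> convergent (\<lambda>j. f ((s \<circ> r) j) (d k))"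
      by (auto simp: convergent_def o_def)
  qed
  have "convergent (\<lambda>j. f ((diagseq \<circ> (+) (Suc k)) j) (d k))" for k
  proof (rule diagseq_holds)
    fix r s :: "nat \<Rightarrow> nat" and n
    assume "strict_mono r" "convergent (\<lambda>j. f (s j) (d n))"
    then show "convergent (\<lambda>j. f ((s \<circ> r) j) (d n))"
      using convergent_subseq_convergent[of "\<lambda>j. f (s j) (d n)" r] by (simp add: o_def)
  qed
  then have "convergent (\<lambda>j. f (diagseq (j + Suc k)) (d k))" for k
    unfolding o_def by (subst add.commute)
  then have "convergent (\<lambda>j. f (diagseq j) (d k))" for k
    using convergent_ignore_initial_segment[of "\<lambda>j. f (diagseq j) (d k)" "Suc k"] by blast
  then have "convergent (\<lambda>j. f (diagseq j) x)" for x
    by (rule convergent_of_dense_range[where f = "\<lambda>j. f (diagseq j)" and d = d, OF lin bd dense])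
  then obtain g where g: "\<And>x. (\<lambda>j. f (diagseq j) x) \<longlonglongrightarrow> g x"
    using choice[of "\<lambda>x l. (\<lambda>j. f (diagseq j) x) \<longlonglongrightarrow> l"] unfolding convergent_def by blast
  show ?thesis
  proof (rule that[OF subseq_diagseq _ _ g])
    show "linear g"
    proof (rule linearI)
      show "g (x + y) = g x + g y" for x y
        using g[of "x + y"] tendsto_add[OF g[of x] g[of y]]
        by (auto simp: linear_add[OF lin] intro: LIMSEQ_unique)
      show "g (r *\<^sub>R x) = r *\<^sub>R g x" for r x
        using g[of "r *\<^sub>R x"] tendsto_scaleR[OF tendsto_const g[of x]]
        by (auto simp: linear_cmul[OF lin] intro: LIMSEQ_unique)
    qed
    show "\<bar>g x\<bar> \<le> C * norm x" for x
      using tendsto_rabs[OF g[of x]] bd by (intro LIMSEQ_le_const2) auto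
  qed
qed

text \<open>
  Conditions that each hold eventually still hold eventually when their parameter is allowed to
  grow slowly enough with \<open>n\<close>; here it is the largest parameter at most \<open>n\<close> whose threshold
  has already been passed.
\<close>

lemma eventually_diagonal:
  fixes P :: "nat \<Rightarrow> nat \<Rightarrow> bool"
  assumes "\<And>N. \<forall>\<^sub>F n in sequentially. P N n"
  obtains \<nu> where "filterlim \<nu> at_top sequentially" "\<forall>\<^sub>F n in sequentially. P (\<nu> n) n"
proof -
  obtain M where M: "\<And>N n. n \<ge> M N \<Longrightarrow> P N n"
    using assms unfolding eventually_sequentially by metis
  define \<nu> where "\<nu> n = Max {N. N \<le> n \<and> (N = 0 \<or> M N \<le> n)}" for n
  have fin: "finite {N. N \<le> n \<and> (N = 0 \<or> M N \<le> n)}" for n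
    by simp
  have mem: "\<nu> n = 0 \<or> M (\<nu> n) \<le> n" for n
    using Max_in[OF fin, of n] by (auto simp: \<nu>_def)
  show ?thesis
  proof (rule that)
    show "filterlim \<nu> at_top sequentially"
      unfolding filterlim_at_top
    proof
      fix Z
      have "Z \<le> \<nu> n" if "n \<ge> max Z (M Z)" for n
        unfolding \<nu>_def using fin that by (intro Max_ge) auto
      then show "\<forall>\<^sub>F n in sequentially. Z \<le> \<nu> n"
        unfolding eventually_sequentially by blast
    qed
    have "P (\<nu> n) n" if "n \<ge> M 0" for n
      using mem[of n] M that by metis
    then show "\<forall>\<^sub>F n in sequentially. P (\<nu> n) n"
      unfolding eventually_sequentially by blast
  qed
qed

text \<open>
  Let \<open>K\<close> consist of the functionals of norm at most \<open>C\<close> that vanish on \<open>Y\<close>. Compactness forces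
  \<open>f n\<close> to approach \<open>K\<close> on any finite part of the dense sequence: otherwise a subsequence that stays
  away from \<open>K\<close> would have a pointwise convergent subsequence, whose limit vanishes on \<open>Y\<close> and so lies
  in \<open>K\<close>. Subtracting from \<open>f n\<close> an element of \<open>K\<close> that is close to it in this sense gives \<open>h n\<close>.
\<close>

theorem Sobczyk_functionals:
  fixes f :: "nat \<Rightarrow> 'a::real_normed_vector \<Rightarrow> real" and d :: "nat \<Rightarrow> 'a"
  assumes lin: "\<And>n. linear (f n)" and bd: "\<And>n x. \<bar>f n x\<bar> \<le> C * norm x" 
    and dense: "closure (range d) = UNIV"
    and null: "\<And>y. y \<in> Y \<Longrightarrow> (\<lambda>n. f n y) \<longlonglongrightarrow> 0"
  obtains h where "\<And>n. linear (h n)" "\<And>n x. \<bar>h n x\<bar> \<le> 2 * C * norm x"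
    "\<And>n y. y \<in> Y \<Longrightarrow> h n y = f n y" "\<And>x. (\<lambda>n. h n x) \<longlonglongrightarrow> 0"
proof -
  define K where "K = {g. linear g \<and> (\<forall>x. \<bar>g x\<bar> \<le> C * norm x) \<and> (\<forall>y\<in>Y. g y = (0::real))}"
  define P where "P N n \<longleftrightarrow> (\<exists>g\<in>K. \<forall>k\<le>N. \<bar>f n (d k) - g (d k)\<bar> \<le> 1 / Suc N)" for N n
  have Cx: "0 \<le> C * norm x" for x :: 'a
    using bd[of 0 x] by linarith
  have K0: "(\<lambda>_. 0) \<in> K"
    using Cx by (simp add: K_def linear_zero)
  have "\<forall>\<^sub>F n in sequentially. P N n" for N
  proof (rule ccontr)
    assume "\<not> (\<forall>\<^sub>F n in sequentially. P N n)"
    then have "infinite {n. \<not> P N n}"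
      by (simp add: not_eventually frequently_cofinite flip: cofinite_eq_sequentially)
    then obtain r :: "nat \<Rightarrow> nat" where r: "strict_mono r" "\<And>j. r j \<in> {n. \<not> P N n}"
      by (rule infinite_enumerate[THEN exE]) blast
    obtain s g where sg: "strict_mono s" "linear g" "\<And>x. \<bar>g x\<bar> \<le> C * norm x"
      "\<And>x. (\<lambda>j. f (r (s j)) x) \<longlonglongrightarrow> g x"
      using functionals_pointwise_seq_compact[of "\<lambda>j. f (r j)" C d] lin bd dense by metis
    have "g y = 0" if "y \<in> Y" for y
    proof -
      have "(\<lambda>j. f (r (s j)) y) \<longlonglongrightarrow> 0"
        using LIMSEQ_subseq_LIMSEQ[OF null[OF that] strict_mono_o[OF r(1) sg(1)]]
        by (simp add: o_def)
      then show ?thesis using sg(4) LIMSEQ_unique by blast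
    qed
    then have "g \<in> K" using sg by (simp add: K_def)
    have "\<forall>\<^sub>F j in sequentially. \<forall>k\<in>{..N}. \<bar>f (r (s j)) (d k) - g (d k)\<bar> < 1 / Suc N"
    proof (rule eventually_ball_finite)
      show "\<forall>k\<in>{..N}. \<forall>\<^sub>F j in sequentially. \<bar>f (r (s j)) (d k) - g (d k)\<bar> < 1 / Suc N"
        using tendstoD[OF sg(4), of "1 / Suc N"] by (auto simp: dist_real_def)
    qed simp
    then obtain j where "\<And>k. k \<le> N \<Longrightarrow> \<bar>f (r (s j)) (d k) - g (d k)\<bar> < 1 / Suc N"
      unfolding eventually_sequentially by auto
    then have "P N (r (s j))"
      using \<open>g \<in> K\<close> unfolding P_def by (meson less_imp_le)
    then show False using r(2)[of "s j"] by simp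
  qed
  then obtain \<nu> where \<nu>: "filterlim \<nu> at_top sequentially" "\<forall>\<^sub>F n in sequentially. P (\<nu> n) n"
    by (rule eventually_diagonal)
  \<comment> \<open>The finitely many \<open>n\<close> without a good approximation get 0, which keeps every \<open>g n\<close> in \<open>K\<close>.\<close>
  define g where "g n = (if P (\<nu> n) n
      then SOME g. g \<in> K \<and> (\<forall>k\<le>\<nu> n. \<bar>f n (d k) - g (d k)\<bar> \<le> 1 / Suc (\<nu> n)) else (\<lambda>_. 0))" for n
  have g: "g n \<in> K \<and> (\<forall>k\<le>\<nu> n. \<bar>f n (d k) - g n (d k)\<bar> \<le> 1 / Suc (\<nu> n))" if "P (\<nu> n) n" for n
  proof -
    have "\<exists>g. g \<in> K \<and> (\<forall>k\<le>\<nu> n. \<bar>f n (d k) - g (d k)\<bar> \<le> 1 / Suc (\<nu> n))"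
      using that unfolding P_def by blast
    from someI_ex[OF this] show ?thesis using that by (simp add: g_def)
  qed
  have gK: "g n \<in> K" for n
    using g K0 by (cases "P (\<nu> n) n") (auto simp: g_def)
  define h where "h n x = f n x - g n x" for n x
  have h_lin: "linear (h n)" for n
    using lin gK unfolding h_def K_def by (auto intro: linear_compose_sub)
  have h_bd: "\<bar>h n x\<bar> \<le> 2 * C * norm x" for n x
  proof -
    have "\<bar>g n x\<bar> \<le> C * norm x"
      using gK[of n] by (simp add: K_def)
    then show ?thesis
      using bd[of n x] unfolding h_def by linarith
  qed
  have h_d: "(\<lambda>n. h n (d k)) \<longlonglongrightarrow> 0" for k
  proof (rule Lim_null_comparison)
    have "\<forall>\<^sub>F n in sequentially. k \<le> \<nu> n"
      using \<nu>(1) by (simp add: filterlim_at_top)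
    then show "\<forall>\<^sub>F n in sequentially. norm (h n (d k)) \<le> inverse (real (Suc (\<nu> n)))"
      using \<nu>(2) by eventually_elim (use g in \<open>auto simp: h_def inverse_eq_divide\<close>)
    show "(\<lambda>n. inverse (real (Suc (\<nu> n)))) \<longlonglongrightarrow> 0"
      using filterlim_compose[OF LIMSEQ_inverse_real_of_nat \<nu>(1)] .
  qed
  have h_null: "(\<lambda>n. h n x) \<longlonglongrightarrow> 0" for x
  proof (rule tendstoI)
    fix e :: real assume e: "e > 0"
    then obtain k where k: "\<And>n. \<bar>h n x - h n (d k)\<bar> \<le> e / 2"
      using equibounded_approx_on_dense[where f = h and d = d and e = "e / 2" and x = x]
        h_lin h_bd dense by (metis half_gt_zero)
    show "\<forall>\<^sub>F n in sequentially. dist (h n x) 0 < e"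
    proof (rule eventually_mono[OF tendstoD[OF h_d, of "e / 2" k]])
      fix n assume "dist (h n (d k)) 0 < e / 2"
      then show "dist (h n x) 0 < e"
        using k[of n] unfolding dist_real_def by linarith
    qed (use e in simp)
  qed
  show ?thesis
    using gK by (intro that[of h] h_lin h_bd h_null) (auto simp: h_def K_def)
qed

section \<open>Seminorms and strict convexity\<close>

definition seminorm :: "('a::real_vector \<Rightarrow> real) \<Rightarrow> bool"
  where "seminorm p \<longleftrightarrow>
    (\<forall>x y. p (x + y) \<le> p x + p y) \<and> (\<forall>r x. p (r *\<^sub>R x) = \<bar>r\<bar> * p x)"

lemma seminorm_triangle: "seminorm p \<Longrightarrow> p (x + y) \<le> p x + p y"
  and seminorm_scale: "seminorm p \<Longrightarrow> p (r *\<^sub>R x) = \<bar>r\<bar> * p x"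
  by (auto simp: seminorm_def)

lemma seminorm_zero: "seminorm p \<Longrightarrow> p 0 = 0"
  using seminorm_scale[of p 0 0] by simp

lemma seminorm_nonneg: "seminorm p \<Longrightarrow> 0 \<le> p x"
  using seminorm_triangle[of p x "- x"] seminorm_scale[of p "- 1" x] seminorm_zero[of p] by simp

lemma seminorm_norm: "seminorm norm"
  by (simp add: seminorm_def norm_triangle_ineq)

lemma seminorm_abs_linear: "linear f \<Longrightarrow> seminorm (\<lambda>x. \<bar>f x\<bar>)"
  by (simp add: seminorm_def linear_add linear_cmul abs_mult abs_triangle_ineq)

lemma seminorm_compose_linear: "seminorm p \<Longrightarrow> linear A \<Longrightarrow> seminorm (\<lambda>x. p (A x))"
  by (simp add: seminorm_def linear_add linear_cmul)

lemma seminorm_cmul: "seminorm p \<Longrightarrow> c \<ge> 0 \<Longrightarrow> seminorm (\<lambda>x. c * p x)"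
  by (simp add: seminorm_def mult_left_mono flip: distrib_left)

lemma seminorm_hypot:
  assumes a: "seminorm a" and b: "seminorm b"
  shows "seminorm (\<lambda>x. sqrt ((a x)\<^sup>2 + (b x)\<^sup>2))"
  unfolding seminorm_def
proof (intro conjI allI)
  fix x y
  have "sqrt ((a (x + y))\<^sup>2 + (b (x + y))\<^sup>2) \<le> sqrt ((a x + a y)\<^sup>2 + (b x + b y)\<^sup>2)"
    using seminorm_triangle[OF a] seminorm_triangle[OF b]
    by (intro real_sqrt_le_mono add_mono power_mono seminorm_nonneg[OF a] seminorm_nonneg[OF b])
  also have "\<dots> \<le> sqrt ((a x)\<^sup>2 + (b x)\<^sup>2) + sqrt ((a y)\<^sup>2 + (b y)\<^sup>2)"
    by (rule real_sqrt_sum_squares_triangle_ineq)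
  finally show "sqrt ((a (x + y))\<^sup>2 + (b (x + y))\<^sup>2)
      \<le> sqrt ((a x)\<^sup>2 + (b x)\<^sup>2) + sqrt ((a y)\<^sup>2 + (b y)\<^sup>2)" .
next
  fix r x
  have "(a (r *\<^sub>R x))\<^sup>2 + (b (r *\<^sub>R x))\<^sup>2 = r\<^sup>2 * ((a x)\<^sup>2 + (b x)\<^sup>2)"
    by (simp add: seminorm_scale[OF a] seminorm_scale[OF b] power_mult_distrib distrib_left)
  then show "sqrt ((a (r *\<^sub>R x))\<^sup>2 + (b (r *\<^sub>R x))\<^sup>2) = \<bar>r\<bar> * sqrt ((a x)\<^sup>2 + (b x)\<^sup>2)"
    by (simp add: real_sqrt_mult)
qed

lemma equivalent_normI:
  assumes q: "seminorm q" and c: "c > 0" and low: "\<And>x. c * norm x \<le> q x"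
    and up: "\<And>x. q x \<le> K * norm x"
  shows "equivalent_norm q"
proof -
  have "q x = 0 \<longleftrightarrow> x = 0" for x
    using low[of x] c seminorm_zero[OF q]
    by (metis mult_pos_pos not_le zero_less_norm_iff)
  moreover have "q x \<le> max K 1 * norm x" for x
    using up[of x] by (meson max.cobounded1 mult_right_mono norm_ge_zero order_trans)
  moreover have "max K 1 > 0" by simp
  ultimately show ?thesis
    using q c low unfolding equivalent_norm_def is_norm_def seminorm_def
    by (intro conjI exI[of _ c] exI[of _ "max K 1"]) simp_all
qed

text \<open>
  The hypothesis in the definition of strict convexity. Naming it allows it to be passed from a composite
  seminorm to its constituents, which need not be strictly convex themselves.
\<close>

definition flat_pair :: "('a::real_vector \<Rightarrow> real) \<Rightarrow> 'a \<Rightarrow> 'a \<Rightarrow> bool"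
  where "flat_pair p x y \<longleftrightarrow> p (x + y) / 2 = p x \<and> p x = p y"

lemma strictly_convex_iff_flat_pair: "strictly_convex p \<longleftrightarrow> (\<forall>x y. flat_pair p x y \<longrightarrow> x = y)"
  by (auto simp: strictly_convex_def flat_pair_def)

text \<open>
  The identity \<open>(s + t)^2 = 2 s^2 + 2 t^2 - (s - t)^2\<close> measures what the triangle inequality loses. Summed
  over \<open>a\<close> and \<open>b\<close>, flatness leaves nothing to lose: it forces both differences
  \<open>a x - a y\<close> and \<open>b x - b y\<close> to vanish, and then no summand can fall short of its maximal value at \<open>x + y\<close>.
\<close>

lemma flat_pair_hypot:
  assumes a: "seminorm a" and b: "seminorm b"
    and flat: "flat_pair (\<lambda>x. sqrt ((a x)\<^sup>2 + (b x)\<^sup>2)) x y"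
  shows "flat_pair a x y" "flat_pair b x y"
proof -
  let ?N = "\<lambda>x. sqrt ((a x)\<^sup>2 + (b x)\<^sup>2)"
  have sq: "(?N z)\<^sup>2 = (a z)\<^sup>2 + (b z)\<^sup>2" for z
    by simp
  have 1: "(a x)\<^sup>2 + (b x)\<^sup>2 = (a y)\<^sup>2 + (b y)\<^sup>2"
    using flat sq[of x] sq[of y] by (simp add: flat_pair_def)
  have "?N (x + y) = 2 * ?N x"
    using flat by (simp add: flat_pair_def)
  then have "(?N (x + y))\<^sup>2 = 4 * (?N x)\<^sup>2"
    by (simp add: power_mult_distrib)
  then have 2: "(a (x + y))\<^sup>2 + (b (x + y))\<^sup>2 = 4 * ((a x)\<^sup>2 + (b x)\<^sup>2)"
    by (simp only: sq)
  have 3: "(a (x + y))\<^sup>2 \<le> (a x + a y)\<^sup>2" "(b (x + y))\<^sup>2 \<le> (b x + b y)\<^sup>2"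
    using seminorm_triangle[OF a] seminorm_triangle[OF b]
    by (auto intro!: power_mono seminorm_nonneg[OF a] seminorm_nonneg[OF b])
  have id: "(s - t)\<^sup>2 = 2 * s\<^sup>2 + 2 * t\<^sup>2 - (s + t)\<^sup>2" for s t :: real
    by (simp add: power2_eq_square algebra_simps)
  have "(a x - a y)\<^sup>2 + (b x - b y)\<^sup>2
      = 2 * ((a x)\<^sup>2 + (b x)\<^sup>2) + 2 * ((a y)\<^sup>2 + (b y)\<^sup>2) - ((a x + a y)\<^sup>2 + (b x + b y)\<^sup>2)"
    unfolding id by (simp only: algebra_simps)
  also have "\<dots> \<le> 2 * ((a x)\<^sup>2 + (b x)\<^sup>2) + 2 * ((a y)\<^sup>2 + (b y)\<^sup>2) - 4 * ((a x)\<^sup>2 + (b x)\<^sup>2)"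
    unfolding 2[symmetric] by (intro diff_left_mono add_mono 3)
  also have "\<dots> = 0"
    using 1 by simp
  finally have "(a x - a y)\<^sup>2 + (b x - b y)\<^sup>2 \<le> 0" .
  then have eq: "a x = a y" "b x = b y"
    by (auto simp: sum_power2_le_zero_iff)
  have "(a (x + y))\<^sup>2 = (2 * a x)\<^sup>2" "(b (x + y))\<^sup>2 = (2 * b x)\<^sup>2"
    using 2 3 eq by (auto simp: power_mult_distrib)
  then have "a (x + y) = 2 * a x" "b (x + y) = 2 * b x"
    using seminorm_nonneg[OF a] seminorm_nonneg[OF b] by (auto intro: power2_eq_imp_eq)
  then show "flat_pair a x y" "flat_pair b x y"
    using eq by (auto simp: flat_pair_def)
qed

locale bounded_functionals =
  fixes \<phi> :: "nat \<Rightarrow> 'a::real_normed_vector \<Rightarrow> real" and C :: real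
  assumes lin: "linear (\<phi> k)" and bd: "\<bar>\<phi> k x\<bar> \<le> C * norm x"
begin

text \<open>
  The weights make the sum converge for equibounded functionals, and they make the seminorm small at
  vectors on which only late functionals are non-zero.
\<close>

definition hilbert_seminorm :: "'a \<Rightarrow> real"
  where "hilbert_seminorm x = sqrt (\<Sum>k. ((1/2)^k * \<phi> k x)\<^sup>2)"

lemma term_le: "((1/2)^k * \<phi> k x)\<^sup>2 \<le> (C * norm x)\<^sup>2 * (1/2)^k"
proof -
  have "((1/2)^k * \<phi> k x)\<^sup>2 = (\<bar>\<phi> k x\<bar>)\<^sup>2 * ((1/2)^k * (1/2)^k)"
    by (simp add: power2_eq_square)
  also have "\<dots> \<le> (C * norm x)\<^sup>2 * ((1/2)^k * 1)"
    using bd[of k x] by (intro mult_mono power_mono) (auto simp: power_le_one)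
  finally show ?thesis by simp
qed

lemma summable_terms: "summable (\<lambda>k. ((1/2)^k * \<phi> k x)\<^sup>2)"
  by (rule summable_comparison_test'[of "\<lambda>k. (C * norm x)\<^sup>2 * (1/2)^k"])
     (use term_le[of _ x] in \<open>auto intro: summable_mult\<close>)

lemma hilbert_seminorm_square: "(hilbert_seminorm x)\<^sup>2 = (\<Sum>k. ((1/2)^k * \<phi> k x)\<^sup>2)"
  unfolding hilbert_seminorm_def by (simp add: suminf_nonneg[OF summable_terms])

lemma hilbert_seminorm_le: "hilbert_seminorm x \<le> 2 * (C * norm x)"
proof (rule power2_le_imp_le)
  have "(hilbert_seminorm x)\<^sup>2 \<le> (\<Sum>k. (C * norm x)\<^sup>2 * (1/2)^k)"
    unfolding hilbert_seminorm_square
    by (rule suminf_le[OF term_le summable_terms]) (auto intro: summable_mult)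
  also have "\<dots> = 2 * (C * norm x)\<^sup>2"
    using suminf_mult[of "\<lambda>k. (1/2::real)^k" "(C * norm x)\<^sup>2"] suminf_geometric[of "1/2::real"] by simp
  also have "\<dots> \<le> (2 * (C * norm x))\<^sup>2"
    by (simp add: power_mult_distrib)
  finally show "(hilbert_seminorm x)\<^sup>2 \<le> (2 * (C * norm x))\<^sup>2" .
  show "0 \<le> 2 * (C * norm x)"
    using bd[of 0 x] by linarith
qed

lemma seminorm_hilbert_seminorm: "seminorm hilbert_seminorm"
  unfolding seminorm_def
proof (intro conjI allI)
  fix x y
  have lim: "(\<lambda>n. L2_set (\<lambda>k. (1/2)^k * \<phi> k z) {..<n}) \<longlonglongrightarrow> hilbert_seminorm z" for z
    unfolding L2_set_def hilbert_seminorm_def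
    by (intro tendsto_real_sqrt summable_LIMSEQ summable_terms)
  show "hilbert_seminorm (x + y) \<le> hilbert_seminorm x + hilbert_seminorm y"
  proof (rule LIMSEQ_le[OF lim tendsto_add[OF lim lim]])
    have "L2_set (\<lambda>k. (1/2)^k * \<phi> k (x + y)) {..<n}
        \<le> L2_set (\<lambda>k. (1/2)^k * \<phi> k x) {..<n} + L2_set (\<lambda>k. (1/2)^k * \<phi> k y) {..<n}" for n
      unfolding linear_add[OF lin] distrib_left by (rule L2_set_triangle_ineq)
    then show "\<exists>N. \<forall>n\<ge>N. L2_set (\<lambda>k. (1/2)^k * \<phi> k (x + y)) {..<n}
        \<le> L2_set (\<lambda>k. (1/2)^k * \<phi> k x) {..<n} + L2_set (\<lambda>k. (1/2)^k * \<phi> k y) {..<n}"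
      by blast
  qed
next
  fix r x
  have "(\<Sum>k. ((1/2)^k * \<phi> k (r *\<^sub>R x))\<^sup>2) = (\<Sum>k. r\<^sup>2 * ((1/2)^k * \<phi> k x)\<^sup>2)"
    by (simp add: linear_cmul[OF lin] power_mult_distrib mult_ac)
  also have "\<dots> = r\<^sup>2 * (\<Sum>k. ((1/2)^k * \<phi> k x)\<^sup>2)"
    by (rule suminf_mult[OF summable_terms])
  finally show "hilbert_seminorm (r *\<^sub>R x) = \<bar>r\<bar> * hilbert_seminorm x"
    by (simp add: hilbert_seminorm_def real_sqrt_mult)
qed

lemma hilbert_seminorm_eq_0: "hilbert_seminorm x = 0 \<Longrightarrow> \<phi> k x = 0"
  using suminf_eq_zero_iff[OF summable_terms[of x]] by (auto simp: hilbert_seminorm_def)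

text \<open>
  By the parallelogram law, a flat pair of a Hilbertian seminorm has a difference of seminorm zero.
\<close>

lemma flat_pair_hilbert_seminorm:
  assumes flat: "flat_pair hilbert_seminorm x y"
  shows "\<phi> k x = \<phi> k y"
proof -
  let ?t = "\<lambda>z k. ((1/2)^k * \<phi> k z)\<^sup>2"
  have "(hilbert_seminorm (x + y))\<^sup>2 + (hilbert_seminorm (x - y))\<^sup>2
      = (\<Sum>k. ?t (x + y) k + ?t (x - y) k)"
    unfolding hilbert_seminorm_square by (rule suminf_add[OF summable_terms summable_terms])
  also have "\<dots> = (\<Sum>k. 2 * (?t x k + ?t y k))"
    by (simp add: linear_add[OF lin] linear_diff[OF lin] power2_eq_square algebra_simps)
  also have "\<dots> = 2 * (\<Sum>k. ?t x k + ?t y k)"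
    by (rule suminf_mult[OF summable_add[OF summable_terms summable_terms]])
  also have "(\<Sum>k. ?t x k + ?t y k) = (hilbert_seminorm x)\<^sup>2 + (hilbert_seminorm y)\<^sup>2"
    unfolding hilbert_seminorm_square by (rule suminf_add[OF summable_terms summable_terms, symmetric])
  finally have "(hilbert_seminorm (x + y))\<^sup>2 + (hilbert_seminorm (x - y))\<^sup>2
      = 2 * ((hilbert_seminorm x)\<^sup>2 + (hilbert_seminorm y)\<^sup>2)" .
  moreover have "hilbert_seminorm (x + y) = 2 * hilbert_seminorm x" "hilbert_seminorm y = hilbert_seminorm x"
    using flat by (auto simp: flat_pair_def)
  ultimately have "hilbert_seminorm (x - y) = 0"
    by (simp add: power_mult_distrib)
  then show ?thesis
    using hilbert_seminorm_eq_0[of "x - y" k] by (simp add: linear_diff[OF lin])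
qed

end

section \<open>Suprema of pointwise null sequences of seminorms\<close>

lemma null_sequence_Sup_attained:
  fixes a :: "nat \<Rightarrow> real"
  assumes nn: "\<And>n. 0 \<le> a n" and null: "a \<longlonglongrightarrow> 0"
  obtains m where "(SUP n. a n) = a m" "\<And>n. a n \<le> a m"
proof -
  have "\<exists>m. \<forall>n. a n \<le> a m"
  proof (cases "\<forall>n. a n = 0")
    case False
    then obtain j where j: "a j > 0" using nn by (metis less_eq_real_def)
    then obtain N where N: "\<And>n. n \<ge> N \<Longrightarrow> a n < a j"
      using order_tendstoD(2)[OF null j] by (auto simp: eventually_sequentially)
    have "Max (a ` {..N}) \<in> a ` {..N}" by (intro Max_in) auto
    then obtain m where m: "m \<le> N" "a m = Max (a ` {..N})" by force
    have le: "a n \<le> a m" if "n \<le> N" for n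
      unfolding m(2) using that by (intro Max_ge) auto
    have "j \<le> N" using N[of j] by force
    then have "a n \<le> a m" for n
      using le[of n] le[of j] N[of n] by (cases "n \<le> N") auto
    then show ?thesis by blast
  qed auto
  then obtain m where m: "\<And>n. a n \<le> a m" by blast
  then have "(SUP n. a n) = a m" by (intro cSup_eq_maximum) auto
  then show ?thesis using m that by blast
qed

text \<open>
  Pointwise convergence to 0 makes the supremum a maximum. This is what preserves rotundity: flatness of
  a maximum is flatness of a seminorm that attains it, whereas flatness of a supremum that is only
  approached need not pass to any single seminorm.
\<close>

locale null_seminorms =
  fixes u :: "nat \<Rightarrow> 'a::real_vector \<Rightarrow> real"
  assumes semi: "seminorm (u n)" and null: "(\<lambda>n. u n x) \<longlonglongrightarrow> 0"
begin

definition sup_seminorm :: "'a \<Rightarrow> real"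
  where "sup_seminorm x = (SUP n. u n x)"

lemma sup_seminorm_attained: obtains m where "sup_seminorm x = u m x"
  using null_sequence_Sup_attained[OF seminorm_nonneg[OF semi] null, of x]
  unfolding sup_seminorm_def by blast

lemma le_sup_seminorm: "u n x \<le> sup_seminorm x"
  using null_sequence_Sup_attained[OF seminorm_nonneg[OF semi] null, of x]
  unfolding sup_seminorm_def by metis

lemma seminorm_sup_seminorm: "seminorm sup_seminorm"
  unfolding seminorm_def
proof (intro conjI allI)
  fix x y
  obtain m where "sup_seminorm (x + y) = u m (x + y)" by (rule sup_seminorm_attained)
  then show "sup_seminorm (x + y) \<le> sup_seminorm x + sup_seminorm y"
    using seminorm_triangle[OF semi, of m x y] le_sup_seminorm[of m x] le_sup_seminorm[of m y]
    by linarith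
next
  fix r x
  obtain m where m: "sup_seminorm (r *\<^sub>R x) = u m (r *\<^sub>R x)" by (rule sup_seminorm_attained)
  obtain l where l: "sup_seminorm x = u l x" by (rule sup_seminorm_attained)
  have "\<bar>r\<bar> * u m x \<le> \<bar>r\<bar> * sup_seminorm x"
    by (intro mult_left_mono le_sup_seminorm) auto
  moreover have "\<bar>r\<bar> * u l x \<le> sup_seminorm (r *\<^sub>R x)"
    using le_sup_seminorm[of l "r *\<^sub>R x"] by (simp add: seminorm_scale[OF semi])
  ultimately show "sup_seminorm (r *\<^sub>R x) = \<bar>r\<bar> * sup_seminorm x"
    unfolding m l seminorm_scale[OF semi] by linarith
qed

lemma flat_pair_sup_seminorm:
  assumes flat: "flat_pair sup_seminorm x y"
  obtains m where "flat_pair (u m) x y"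
proof -
  obtain m where m: "sup_seminorm (x + y) = u m (x + y)" by (rule sup_seminorm_attained)
  have "flat_pair (u m) x y"
    using flat m seminorm_triangle[OF semi, of m x y] le_sup_seminorm[of m x] le_sup_seminorm[of m y]
    unfolding flat_pair_def by linarith
  then show ?thesis by (rule that)
qed

end

section \<open>The renorming\<close>

lift_definition unit_c0 :: "nat \<Rightarrow> c0" is "\<lambda>m n. if n = m then 1 else 0"
proof -
  fix m :: nat
  have "\<forall>\<^sub>F n in sequentially. (if n = m then 1 else 0) = (0::real)"
    using eventually_gt_at_top[of m] by eventually_elim auto
  then show "(\<lambda>n. if n = m then 1 else 0::real) \<longlonglongrightarrow> 0"
    by (rule tendsto_eventually)
qed

lemma linear_c0_nth: "linear (\<lambda>a. c0_nth a n)"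
  by (rule linearI) (simp_all add: plus_c0.rep_eq scaleR_c0.rep_eq)

text \<open>
  The weights \<open>2^-n\<close> on \<open>r\<close> serve two opposite ends: they tend to 0, so that the supremum is attained,
  but none of them is 0, so that each \<open>u n\<close> retains the rotundity of \<open>r\<close>. The term \<open>p (x - T (Q x))\<close>
  vanishes on the copy of the null sequences; on that copy \<open>r\<close> is only the weighted Hilbertian seminorm,
  which is small on late unit vectors.
\<close>

theorem strictly_convex_almost_square_renorming:
  fixes p :: "'a::real_normed_vector \<Rightarrow> real" and T :: "c0 \<Rightarrow> 'a" and Q :: "'a \<Rightarrow> c0"
  assumes p: "equivalent_norm p" "strictly_convex p"
    and T: "bounded_linear T" and Q: "bounded_linear Q" and QT: "\<And>a. Q (T a) = a"
  shows "\<exists>q :: 'a \<Rightarrow> real. equivalent_norm q \<and> strictly_convex q \<and> almost_square q"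
proof -
  interpret T: bounded_linear T by (rule T)
  interpret Q: bounded_linear Q by (rule Q)
  obtain c B where c: "c > 0" "\<And>x. c * norm x \<le> p x" and B: "B > 0" "\<And>x. p x \<le> B * norm x"
    using p(1) unfolding equivalent_norm_def by blast
  have semi_p: "seminorm p"
    using p(1) by (simp add: equivalent_norm_def is_norm_def seminorm_def)
  obtain K where K: "K > 0" "\<And>x. norm (Q x) \<le> K * norm x"
    using Q.pos_bounded by (auto simp: mult.commute)
  obtain L where L: "L > 0" "\<And>a. norm (T a) \<le> L * norm a"
    using T.pos_bounded by (auto simp: mult.commute)
  define f where "f n x = c0_nth (Q x) n" for n x
  have f_lin: "linear (f n)" for n
    using linear_compose[OF Q.linear linear_c0_nth[of n]] by (simp add: f_def[abs_def] o_def)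
  have f_le: "\<bar>f n x\<bar> \<le> norm (Q x)" for n x
    unfolding f_def by (rule abs_c0_nth_le_norm)
  have f_unit: "f n (T (unit_c0 m)) = (if n = m then 1 else 0)" for n m
    by (simp add: f_def QT unit_c0.rep_eq)
  interpret f: bounded_functionals f K
    by (rule bounded_functionals.intro[OF f_lin order_trans[OF f_le K(2)]])
  define b where "b x = p (x - T (Q x))" for x
  have lin_b: "linear (\<lambda>x. x - T (Q x))"
    by (intro linear_compose_sub linear_id[unfolded id_def] linear_compose[OF Q.linear T.linear, unfolded o_def])
  have semi_b: "seminorm b"
    unfolding b_def by (rule seminorm_compose_linear[OF semi_p lin_b])
  define r where "r x = sqrt ((b x)\<^sup>2 + (f.hilbert_seminorm x)\<^sup>2)" for x
  have semi_r: "seminorm r"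
    unfolding r_def by (rule seminorm_hypot[OF semi_b f.seminorm_hilbert_seminorm])
  have r_unit: "r (T (unit_c0 m)) = (1/2)^m" for m
  proof -
    have "(\<lambda>k. ((1/2)^k * f k (T (unit_c0 m)))\<^sup>2) = (\<lambda>k. if k = m then ((1/2)^k)\<^sup>2 else 0)"
      by (auto simp: f_unit)
    then have "(f.hilbert_seminorm (T (unit_c0 m)))\<^sup>2 = ((1/2)^m)\<^sup>2"
      using sums_unique[OF sums_single[of m "\<lambda>k. ((1/2::real)^k)\<^sup>2"]]
      by (simp add: f.hilbert_seminorm_square)
    moreover have "b (T (unit_c0 m)) = 0"
      by (simp add: b_def QT seminorm_zero[OF semi_p])
    ultimately show ?thesis by (simp add: r_def)
  qed
  define u where "u n x = sqrt ((\<bar>f n x\<bar>)\<^sup>2 + ((1/2)^n * r x)\<^sup>2)" for n x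
  have semi_u1: "seminorm (\<lambda>x. \<bar>f n x\<bar>)" and semi_u2: "seminorm (\<lambda>x. (1/2)^n * r x)" for n
    using seminorm_abs_linear[OF f_lin] seminorm_cmul[OF semi_r] by auto
  have r_nn: "r x \<ge> 0" for x by (rule seminorm_nonneg[OF semi_r])
  have u_le: "u n x \<le> \<bar>f n x\<bar> + (1/2)^n * r x" for n x
    unfolding u_def using r_nn by (intro sqrt_sum_squares_le_sum) auto
  interpret u: null_seminorms u
  proof
    show "seminorm (u n)" for n
      unfolding u_def by (rule seminorm_hypot[OF semi_u1 semi_u2])
    show "(\<lambda>n. u n x) \<longlonglongrightarrow> 0" for x
    proof (rule tendsto_sandwich[OF _ _ tendsto_const])
      have "(\<lambda>n. \<bar>f n x\<bar> + (1/2)^n * r x) \<longlonglongrightarrow> \<bar>0\<bar> + 0 * r x"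
        unfolding f_def
        by (intro tendsto_add tendsto_mult tendsto_rabs c0_nth_tendsto LIMSEQ_power_zero tendsto_const) simp
      then show "(\<lambda>n. \<bar>f n x\<bar> + (1/2)^n * r x) \<longlonglongrightarrow> 0" by simp
    qed (use u_le in \<open>auto simp: u_def\<close>)
  qed
  define q where "q = u.sup_seminorm"
  have semi_q: "seminorm q" unfolding q_def by (rule u.seminorm_sup_seminorm)
  have u_le_q: "u n x \<le> q x" for n x unfolding q_def by (rule u.le_sup_seminorm)
  have f_le_q: "\<bar>f n x\<bar> \<le> q x" for n x
    using real_sqrt_sum_squares_ge1[of "\<bar>f n x\<bar>"] u_le_q[of n x] unfolding u_def
    by (rule order_trans)
  have r_le_q: "r x \<le> q x" for x
    using u_le_q[of 0 x] by (auto simp: u_def intro: order_trans[OF real_sqrt_sum_squares_ge2])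
  have equiv: "equivalent_norm q"
  proof (rule equivalent_normI[OF semi_q])
    show "c / (1 + B * L) > 0" using c B(1) L(1) by (simp add: add_pos_pos)
    fix x
    have "c * norm x \<le> p (x - T (Q x)) + p (T (Q x))"
      using c(2)[of x] seminorm_triangle[OF semi_p, of "x - T (Q x)" "T (Q x)"] by simp
    also have "p (x - T (Q x)) \<le> q x"
      using real_sqrt_sum_squares_ge1[of "b x"] r_le_q[of x] unfolding r_def b_def
      by (rule order_trans)
    also have "p (T (Q x)) \<le> B * (L * norm (Q x))"
      using B L(2) by (meson mult_left_mono less_imp_le order_trans)
    also have "\<dots> \<le> B * (L * q x)"
      using B(1) L(1) f_le_q[unfolded f_def] by (intro mult_left_mono norm_c0_le) auto
    finally have "c * norm x \<le> (1 + B * L) * q x" by (simp add: algebra_simps)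
    then show "c / (1 + B * L) * norm x \<le> q x"
      using B(1) L(1) by (simp add: field_simps add_pos_pos)
    have "norm (T (Q x)) \<le> L * (K * norm x)"
      using L(1) L(2)[of "Q x"] K(2)[of x] by (meson mult_left_mono less_imp_le order_trans)
    then have "norm (x - T (Q x)) \<le> norm x + L * (K * norm x)"
      using norm_triangle_ineq4[of x "T (Q x)"] by linarith
    then have "b x \<le> B * (norm x + L * (K * norm x))"
      unfolding b_def using B by (meson mult_left_mono less_imp_le order_trans)
    moreover have "r x \<le> b x + f.hilbert_seminorm x"
      unfolding r_def using seminorm_nonneg[OF semi_b] seminorm_nonneg[OF f.seminorm_hilbert_seminorm]
      by (intro sqrt_sum_squares_le_sum) auto
    ultimately have r_le: "r x \<le> B * (norm x + L * (K * norm x)) + 2 * (K * norm x)"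
      using f.hilbert_seminorm_le[of x] by linarith
    obtain m where "q x = u m x" unfolding q_def by (rule u.sup_seminorm_attained)
    moreover have "(1/2)^m * r x \<le> r x"
      using r_nn by (simp add: mult_left_le_one_le power_le_one)
    ultimately have "q x \<le> K * norm x + (B * (norm x + L * (K * norm x)) + 2 * (K * norm x))"
      using u_le[of m x] f.bd[of m x] r_le by linarith
    then show "q x \<le> (K + (B * (1 + L * K) + 2 * K)) * norm x"
      by (simp add: algebra_simps)
  qed
  have convex: "strictly_convex q"
    unfolding strictly_convex_iff_flat_pair
  proof (intro allI impI)
    fix x y assume "flat_pair q x y"
    then obtain m where "flat_pair (u m) x y"
      unfolding q_def by (rule u.flat_pair_sup_seminorm)
    then have "flat_pair (\<lambda>x. (1/2)^m * r x) x y"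
      unfolding u_def by (rule flat_pair_hypot(2)[OF semi_u1 semi_u2])
    then have "flat_pair r x y" by (simp add: flat_pair_def)
    then have flat: "flat_pair b x y" "flat_pair f.hilbert_seminorm x y"
      unfolding r_def using flat_pair_hypot[OF semi_b f.seminorm_hilbert_seminorm] by blast+
    have "c0_nth (Q x) = c0_nth (Q y)"
      using f.flat_pair_hilbert_seminorm[OF flat(2)] by (simp add: f_def fun_eq_iff)
    then have "Q x = Q y" by (simp add: c0_nth_inject)
    moreover have "flat_pair p (x - T (Q x)) (y - T (Q y))"
      using flat(1) by (simp add: flat_pair_def b_def Q.add T.add algebra_simps)
    then have "x - T (Q x) = y - T (Q y)"
      using p(2) unfolding strictly_convex_iff_flat_pair by blast
    ultimately show "x = y" by simp
  qed
  have "almost_square q"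
    unfolding almost_square_def
  proof (intro allI impI)
    fix F and \<epsilon> :: real
    assume F: "finite F \<and> F \<subseteq> {x. q x = 1}" and \<epsilon>: "\<epsilon> > 0"
    have "\<forall>\<^sub>F m in sequentially. \<forall>x\<in>F. u m x < \<epsilon>"
      using F order_tendstoD(2)[OF u.null \<epsilon>] by (intro eventually_ball_finite) auto
    moreover have "\<forall>\<^sub>F m in sequentially. (1/2)^m < \<epsilon>"
      using order_tendstoD(2)[OF LIMSEQ_power_zero \<epsilon>, of "1/2::real"] by simp
    ultimately have "\<forall>\<^sub>F m in sequentially. (\<forall>x\<in>F. u m x < \<epsilon>) \<and> (1/2)^m < \<epsilon>"
      by (rule eventually_conj)
    then obtain m where m: "\<And>x. x \<in> F \<Longrightarrow> u m x < \<epsilon>" "(1/2)^m < \<epsilon>"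
      unfolding eventually_sequentially by auto
    define d where "d = T (unit_c0 m)"
    have q_ge: "q d \<ge> 1"
      using f_le_q[of m d] by (simp add: d_def f_unit)
    define y where "y = (1 / q d) *\<^sub>R d"
    have qy: "q y = 1"
      using q_ge by (simp add: y_def seminorm_scale[OF semi_q])
    have "q (x + y) \<le> 1 + \<epsilon>" if x: "x \<in> F" for x
    proof -
      have qx: "q x = 1" using F x by auto
      obtain n where n: "q (x + y) = u n (x + y)" unfolding q_def by (rule u.sup_seminorm_attained)
      have tri: "u n (x + y) \<le> u n x + u n y" by (rule seminorm_triangle[OF u.semi])
      show ?thesis
      \<comment> \<open>At \<open>m\<close> the vector \<open>y\<close> contributes up to 1 but \<open>x\<close> almost nothing; elsewhere the roles are exchanged.\<close>
      proof (cases "n = m")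
        case True
        then show ?thesis using n tri m(1)[OF x] u_le_q[of n y] qy by simp
      next
        case False
        have "u n y = u n d / q d"
          using q_ge by (simp add: y_def seminorm_scale[OF u.semi])
        also have "\<dots> \<le> u n d / 1"
          using q_ge seminorm_nonneg[OF u.semi] by (intro divide_left_mono) auto
        also have "u n d \<le> (1/2)^n * (1/2)^m"
          using u_le[of n d] False by (simp add: d_def f_unit r_unit)
        also have "(1/2)^n * (1/2)^m \<le> (1/2::real)^m"
          by (simp add: mult_left_le_one_le power_le_one)
        finally show ?thesis using n tri m(2) u_le_q[of n x] qx by simp
      qed
    qed
    then show "\<exists>y. q y = 1 \<and> (\<forall>x\<in>F. q (x + y) \<le> 1 + \<epsilon>)" using qy by blast
  qed
  then show ?thesis using equiv convex by blast
qed

section \<open>Complemented copies and separable spaces\<close>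

lemma complemented_copy_retraction:
  fixes Y :: "'a::real_normed_vector set"
  assumes "isomorphic_to_c0 Y" and "complemented Y"
  obtains T :: "c0 \<Rightarrow> 'a" and Q where "bounded_linear T" "bounded_linear Q" "\<And>a. Q (T a) = a"
proof -
  obtain T :: "c0 \<Rightarrow> 'a" and c where T: "bounded_linear T" "range T = Y" and c: "c > 0" "\<And>a. c * norm a \<le> norm (T a)"
    using assms(1) unfolding isomorphic_to_c0_def by blast
  obtain P where P: "bounded_linear P" "P \<circ> P = P" "range P = Y"
    using assms(2) unfolding complemented_def by blast
  interpret T: bounded_linear T by (rule T(1))
  interpret P: bounded_linear P by (rule P(1))
  have "inj T"
  proof (rule injI)
    fix a b assume "T a = T b"
    then have "c * norm (a - b) \<le> 0" using c(2)[of "a - b"] by (simp add: T.diff)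
    then show "a = b" using c(1) by (simp add: mult_le_0_iff)
  qed
  define Q where "Q x = inv T (P x)" for x
  have TQ: "T (Q x) = P x" for x
    unfolding Q_def using P(3) T(2) by (intro f_inv_into_f) auto
  have PT: "P (T a) = T a" for a
  proof -
    obtain x where "T a = P x" using P(3) T(2) by blast
    then show ?thesis using P(2) by (metis comp_apply)
  qed
  obtain K where K: "\<And>x. norm (P x) \<le> norm x * K" using P.bounded by blast
  have "bounded_linear Q"
  proof (rule bounded_linear_intro)
    show "Q (x + y) = Q x + Q y" for x y
      by (rule injD[OF \<open>inj T\<close>]) (simp add: TQ T.add P.add)
    show "Q (s *\<^sub>R x) = s *\<^sub>R Q x" for s x
      by (rule injD[OF \<open>inj T\<close>]) (simp add: TQ T.scaleR P.scaleR)
    show "norm (Q x) \<le> norm x * (K / c)" for x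
      using c(2)[of "Q x"] K[of x] c(1) by (simp add: TQ field_simps)
  qed
  moreover have "Q (T a) = a" for a
    using \<open>inj T\<close> by (simp add: Q_def PT)
  ultimately show ?thesis using T(1) that by blast
qed

lemma separable_space_dense_sequence:
  assumes "separable_space (euclidean :: 'a::real_normed_vector topology)"
  obtains d :: "nat \<Rightarrow> 'a::real_normed_vector" where "closure (range d) = UNIV"
proof -
  obtain D :: "'a set" where D: "countable D" "closure D = UNIV"
    using assms by (auto simp: separable_space_def)
  then have "D \<noteq> {}" by auto
  then have "range (from_nat_into D) = D" using D(1) by (rule range_from_nat_into)
  then show ?thesis using that D(2) by metis
qed

text \<open>
  Functionals that norm the members of a dense sequence separate points, so a flat pair of the
  Hilbertian seminorm built from them is trivial.
\<close>

theorem separable_strictly_convex_renorming: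
  fixes d :: "nat \<Rightarrow> 'a::real_normed_vector"
  assumes dense: "closure (range d) = UNIV"
  shows "\<exists>p :: 'a \<Rightarrow> real. equivalent_norm p \<and> strictly_convex p"
proof -
  have "\<exists>g. linear g \<and> g (d k) = norm (d k) \<and> (\<forall>y. \<bar>g y\<bar> \<le> norm y)" for k
    using norming_functional[of "d k"] by blast
  then obtain \<phi> where \<phi>: "\<And>k. linear (\<phi> k)" "\<And>k. \<phi> k (d k) = norm (d k)" "\<And>k y. \<bar>\<phi> k y\<bar> \<le> norm y"
    by metis
  interpret bounded_functionals \<phi> 1
    by (rule bounded_functionals.intro) (simp_all add: \<phi>)
  have separating: "x = 0" if "\<And>k. \<phi> k x = 0" for x
  proof (rule ccontr)
    assume "x \<noteq> 0"
    then obtain k where k: "dist (d k) x < norm x / 2"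
      using dense closure_approachable[of x "range d"] by (auto dest: spec[of _ "norm x / 2"])
    \<comment> \<open>A functional that norms \<open>d k\<close> and kills \<open>x\<close> cannot distinguish \<open>d k\<close> from \<open>d k - x\<close>.\<close>
    have "norm (d k) \<le> norm (d k - x)"
      using \<phi>(3)[of k "d k - x"] that[of k] \<phi>(2)[of k] by (simp add: linear_diff[OF \<phi>(1)])
    moreover have "norm x \<le> norm (d k) + norm (d k - x)"
      by (metis norm_minus_commute norm_triangle_sub)
    ultimately show False using k by (simp add: dist_norm)
  qed
  define p where "p x = sqrt ((norm x)\<^sup>2 + (hilbert_seminorm x)\<^sup>2)" for x
  have "equivalent_norm p"
  proof (rule equivalent_normI)
    show "seminorm p"
      unfolding p_def by (rule seminorm_hypot[OF seminorm_norm seminorm_hilbert_seminorm])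
    show "1 * norm x \<le> p x" for x by (simp add: p_def)
    have "p x \<le> norm x + hilbert_seminorm x" for x
      unfolding p_def using seminorm_nonneg[OF seminorm_hilbert_seminorm]
      by (intro sqrt_sum_squares_le_sum) auto
    then show "p x \<le> 3 * norm x" for x
      using hilbert_seminorm_le[of x] by (smt (verit))
  qed simp
  moreover have "x = y" if "flat_pair p x y" for x y
  proof -
    have "flat_pair hilbert_seminorm x y"
      using that unfolding p_def
      by (rule flat_pair_hypot(2)[OF seminorm_norm seminorm_hilbert_seminorm])
    then have "\<phi> k (x - y) = 0" for k
      using flat_pair_hilbert_seminorm by (simp add: linear_diff[OF \<phi>(1)])
    then have "x - y = 0" by (rule separating)
    then show ?thesis by simp
  qed
  ultimately show ?thesis by (auto simp: strictly_convex_iff_flat_pair)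
qed

text \<open>
  Pointwise null extensions of the coordinate functionals are the coordinates of an operator into the space of
  null sequences, and that operator inverts \<open>T\<close>.
\<close>

theorem Sobczyk:
  fixes T :: "c0 \<Rightarrow> 'a::real_normed_vector" and d :: "nat \<Rightarrow> 'a"
  assumes T: "bounded_linear T" and c: "c > 0" "\<And>a. c * norm a \<le> norm (T a)"
    and dense: "closure (range d) = UNIV"
  obtains Q where "bounded_linear Q" "\<And>a. Q (T a) = a"
proof -
  interpret T: bounded_linear T by (rule T)
  have bound: "c0_nth a n \<le> 1 / c * norm (T a)" for a n
    using abs_c0_nth_le_norm[of a n] c(1) c(2)[of a] by (simp add: field_simps)
       (smt (verit) mult_left_mono)
  have "\<exists>g. linear g \<and> (\<forall>a. g (T a) = c0_nth a n) \<and> (\<forall>x. \<bar>g x\<bar> \<le> 1 / c * norm x)" for n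
    by (rule functional_factors_through[OF T.linear linear_c0_nth bound]) (use c(1) in auto)
  then obtain f where f: "\<And>n. linear (f n)" "\<And>n a. f n (T a) = c0_nth a n"
      "\<And>n x. \<bar>f n x\<bar> \<le> 1 / c * norm x"
    by metis
  have null: "(\<lambda>n. f n y) \<longlonglongrightarrow> 0" if "y \<in> range T" for y
    using that c0_nth_tendsto by (auto simp: f(2))
  obtain h where h: "\<And>n. linear (h n)" "\<And>n x. \<bar>h n x\<bar> \<le> 2 * (1 / c) * norm x"
      "\<And>n y. y \<in> range T \<Longrightarrow> h n y = f n y" "\<And>x. (\<lambda>n. h n x) \<longlonglongrightarrow> 0"
    using Sobczyk_functionals[OF f(1) f(3) dense null] by blast
  define Q where "Q x = Abs_c0 (\<lambda>n. h n x)" for x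
  have nth_Q: "c0_nth (Q x) = (\<lambda>n. h n x)" for x
    using h(4) by (simp add: Q_def Abs_c0_inverse)
  have "bounded_linear Q"
  proof (rule bounded_linear_intro)
    show "Q (x + y) = Q x + Q y" for x y
      by (simp add: nth_Q plus_c0.rep_eq linear_add[OF h(1)] flip: c0_nth_inject)
    show "Q (s *\<^sub>R x) = s *\<^sub>R Q x" for s x
      by (simp add: nth_Q scaleR_c0.rep_eq linear_cmul[OF h(1)] flip: c0_nth_inject)
    show "norm (Q x) \<le> norm x * (2 * (1 / c))" for x
      using h(2)[of _ x] by (intro norm_c0_le) (simp add: nth_Q mult.commute)
  qed
  moreover have "Q (T a) = a" for a
    by (simp add: nth_Q h(3) f(2) flip: c0_nth_inject)
  ultimately show ?thesis by (rule that)
qed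

theorem corollary5p4:
  shows
    "((\<exists>p :: 'a::banach \<Rightarrow> real. equivalent_norm p \<and> strictly_convex p) \<and>
      (\<exists>Y :: 'a set. isomorphic_to_c0 Y \<and> complemented Y) \<longrightarrow>
      (\<exists>q :: 'a \<Rightarrow> real. equivalent_norm q \<and> strictly_convex q \<and> almost_square q)) \<and>
     (separable_space (euclidean :: 'a topology) \<and> (\<exists>Y :: 'a set. isomorphic_to_c0 Y) \<longrightarrow>
      (\<exists>q :: 'a \<Rightarrow> real. equivalent_norm q \<and> strictly_convex q \<and> almost_square q))"
proof (intro conjI impI)
  assume "(\<exists>p :: 'a \<Rightarrow> real. equivalent_norm p \<and> strictly_convex p) \<and>
      (\<exists>Y :: 'a set. isomorphic_to_c0 Y \<and> complemented Y)"
  then obtain p :: "'a \<Rightarrow> real" and Y :: "'a set" where p: "equivalent_norm p" "strictly_convex p"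
    and Y: "isomorphic_to_c0 Y" "complemented Y"
    by blast
  obtain T :: "c0 \<Rightarrow> 'a" and Q where "bounded_linear T" "bounded_linear Q" "\<And>a. Q (T a) = a"
    using complemented_copy_retraction[OF Y] by blast
  then show "\<exists>q :: 'a \<Rightarrow> real. equivalent_norm q \<and> strictly_convex q \<and> almost_square q"
    by (rule strictly_convex_almost_square_renorming[OF p])
next
  assume "separable_space (euclidean :: 'a topology) \<and> (\<exists>Y :: 'a set. isomorphic_to_c0 Y)"
  then have sep: "separable_space (euclidean :: 'a topology)" and "\<exists>Y :: 'a set. isomorphic_to_c0 Y"
    by auto
  then obtain T :: "c0 \<Rightarrow> 'a" and c where T: "bounded_linear T" "c > 0" "\<And>a. c * norm a \<le> norm (T a)"
    unfolding isomorphic_to_c0_def by blast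
  obtain d :: "nat \<Rightarrow> 'a" where d: "closure (range d) = UNIV"
    using separable_space_dense_sequence[OF sep] by blast
  obtain Q where "bounded_linear Q" "\<And>a. Q (T a) = a"
    using Sobczyk[OF T d] by blast
  moreover obtain p :: "'a \<Rightarrow> real" where "equivalent_norm p" "strictly_convex p"
    using separable_strictly_convex_renorming[OF d] by blast
  ultimately show "\<exists>q :: 'a \<Rightarrow> real. equivalent_norm q \<and> strictly_convex q \<and> almost_square q"
    using strictly_convex_almost_square_renorming T(1) by blast
qed

end
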